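(* Let $h\ge 0$ be an integer. If $h\equiv 0\pmod 4$, a monomial basis of $Q_h^{(1)}M$ is represented by $$\{v_{h-4-8a,\,2+4a}: a\ge 0,\ h-4-8a\ge 0\},$$ together with $v_{0,h/2}$ when $h\equiv 0\pmod 8$. If $h\equiv 2\pmod 4$, a monomial basis of $Q_h^{(1)}M$ is represented by $$\{v_{h-8a,\,4a}: a\ge 0,\ h-8a\ge 0\},$$ together with $v_{0,h/2}$ when $h\equiv 6\pmod 8$. If $h$ is odd, the basis is empty.
   Context: Let $M=\widetilde H^*(MO(2);\mathbb F_2)$ be the reduced mod $2$ cohomology of the Thom space $MO(2)$ of the universal real two-plane bundle. Write $S=H^*(BO(2);\mathbb F_2)=\mathbb F_2[w_1,w_2]$ with $|w_1|=1$, $|w_2|=2$ (Stiefel--Whitney classes; by the splitting principle $S=\mathbb F_2[x,y]^{\mathfrak S_2}$ with $w_1=x+y$, $w_2=xy$, $|x|=|y|=1$). Then $M=uS$ is free over $S$ on the Thom class $u$ of degree $2$, and the Steenrod squares act on $M$ by the Cartan formula, the usual action on $S$, and the Thom identity $\mathrm{Sq}(u)=u(1+w_1+w_2)$ for the total square $\mathrm{Sq}=\sum_k \mathrm{Sq}^k$. For $n,m\ge 0$ let $v_{n,m}=u\,w_1^n w_2^m$. Its internal degree is $n+2m$ (its cohomological degree is $n+2m+2$). For $h\ge 0$ let $M_h=\mathrm{span}_{\mathbb F_2}\{v_{n,m}: n+2m=h\}$. Let $\mathcal A(1)$ be the subalgebra of the mod $2$ Steenrod algebra generated by $\mathrm{Sq}^1,\mathrm{Sq}^2$,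 with augmentation ideal $\mathcal A(1)^+$ (its elements of positive degree). Put $Q_h^{(1)}M=M_h/(\mathcal A(1)^+M)_h$, where the subscript $h$ denotes the component of internal degree $h$. A family in $M_h$ "represents a basis" if the classes of its members form a basis of the quotient. *)

theory Defs
  imports "HOL-Library.Z2" "HOL-Library.Poly_Mapping" "HOL-Computational_Algebra.Polynomial"
begin

section \<open>The ring $S = \mathbb{F}_2[w_1,w_2]$ and its Steenrod squares\<close>

text \<open>
  \<open>S\<close> is the ring of polynomials in \<open>w\<^sub>2\<close> (outer variable) over the polynomials in
  \<open>w\<^sub>1\<close> (inner variable). The same type with variables \<open>x\<close> (inner) and \<open>y\<close> (outer)
  is used for the target of the splitting principle below.
\<close>

type_synonym S = "bit poly poly"

definition w1 :: S where "w1 = [:[:0, 1:]:]"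

definition w2 :: S where "w2 = [:0, 1:]"

definition bisubst :: "S \<Rightarrow> 'r::comm_ring_1 \<Rightarrow> 'r \<Rightarrow> 'r" where
  "bisubst f a b = poly (map_poly (\<lambda>p. poly (map_poly of_bit p) a) f) b"

text \<open>
  The squares are packaged in a total square with a formal parameter \<open>t\<close>, namely
  \<open>Sq\<^sub>t f = (\<Sum>k. t ^ k * Sq\<^sup>k f)\<close>, a ring homomorphism from \<open>S\<close> to \<open>S[t]\<close> by
  the Cartan formula. The values at \<open>w\<^sub>1 = x + y\<close> and \<open>w\<^sub>2 = xy\<close> come from
  \<open>Sq\<^sub>t x = x + t x\<^sup>2\<close> and \<open>Sq\<^sub>t y = y + t y\<^sup>2\<close>; see \<open>splitting_sq_tot\<close>.
\<close>

definition sq_tot :: "S \<Rightarrow> S poly" where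
  "sq_tot f = bisubst f [:w1, w1 ^ 2:] ([:w2:] * [:1, w1, w2:])"

definition Sq_S :: "nat \<Rightarrow> S \<Rightarrow> S" where
  "Sq_S k f = coeff (sq_tot f) k"

section \<open>The module $M = uS$\<close>

text \<open>
  Since \<open>M\<close> is free of rank one on the Thom class \<open>u\<close>, the element \<open>u f\<close> is represented
  by its coordinate \<open>f\<close>. The first factor below is the Thom identity
  \<open>Sq\<^sub>t u = u (1 + w\<^sub>1 t + w\<^sub>2 t\<^sup>2)\<close>.
\<close>

type_synonym M = S

definition Sq_M :: "nat \<Rightarrow> M \<Rightarrow> M" where
  "Sq_M k f = coeff ([:1, w1, w2:] * sq_tot f) k"

definition v :: "nat \<Rightarrow> nat \<Rightarrow> M" where
  "v n m = w1 ^ n * w2 ^ m"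

abbreviation scaleM :: "bit \<Rightarrow> M \<Rightarrow> M" where
  "scaleM c f \<equiv> smult [:c:] f"

interpretation M: vector_space scaleM
  by unfold_locales (simp_all add: smult_add_right smult_add_left flip: one_pCons smult_add_left)

definition M_deg :: "nat \<Rightarrow> M set" where
  "M_deg h = M.span {v n m | n m. n + 2 * m = h}"

section \<open>Properties of the squares\<close>

lemma poly_map_poly_add:
  assumes "\<phi> 0 = 0" "\<And>p q. \<phi> (p + q) = \<phi> p + \<phi> q"
  shows "poly (map_poly \<phi> (f + g)) b = poly (map_poly \<phi> f) b + poly (map_poly \<phi> g) (b::'r::comm_ring_1)"
proof -
  have "map_poly \<phi> (f + g) = map_poly \<phi> f + map_poly \<phi> g"
    by (intro poly_eqI) (simp add: coeff_map_poly assms)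
  then show ?thesis by simp
qed

lemma poly_map_poly_mult:
  fixes f g :: "'s::comm_ring_1 poly" and b :: "'r::comm_ring_1"
  assumes [simp]: "\<phi> 0 = 0" and add: "\<And>p q. \<phi> (p + q) = \<phi> p + \<phi> q"
    and mult: "\<And>p q. \<phi> (p * q) = \<phi> p * \<phi> q"
  shows "poly (map_poly \<phi> (f * g)) b = poly (map_poly \<phi> f) b * poly (map_poly \<phi> g) b"
proof -
  have sm: "map_poly \<phi> (smult c g) = smult (\<phi> c) (map_poly \<phi> g)" for c
    by (intro poly_eqI) (simp add: coeff_map_poly mult)
  show ?thesis
    by (induction f)
      (simp_all add: poly_map_poly_add[of \<phi>, OF assms(1) add] map_poly_pCons sm algebra_simps)
qed

context
  fixes a b :: "'r::comm_ring_1"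
  assumes two: "(2::'r) = 0"
begin

lemma of_bit_add: "(of_bit (c + d) :: 'r) = of_bit c + of_bit d"
  using two by (cases c; cases d) simp_all

lemma of_bit_mult: "(of_bit (c * d) :: 'r) = of_bit c * of_bit d"
  by (cases c; cases d) simp_all

lemma poly_of_bit_add:
  "poly (map_poly of_bit (p + q)) a = poly (map_poly of_bit p) a + poly (map_poly of_bit q) a"
  by (rule poly_map_poly_add[OF _ of_bit_add]) simp

lemma poly_of_bit_mult:
  "poly (map_poly of_bit (p * q)) a = poly (map_poly of_bit p) a * poly (map_poly of_bit q) a"
  by (rule poly_map_poly_mult[OF _ of_bit_add of_bit_mult]) simp

lemma bisubst_add: "bisubst (f + g) a b = bisubst f a b + bisubst g a b"
  unfolding bisubst_def by (rule poly_map_poly_add[OF _ poly_of_bit_add]) simp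

lemma bisubst_mult: "bisubst (f * g) a b = bisubst f a b * bisubst g a b"
  unfolding bisubst_def by (rule poly_map_poly_mult[OF _ poly_of_bit_add poly_of_bit_mult]) simp

end

lemma bisubst_0 [simp]: "bisubst 0 a b = 0"
  and bisubst_1 [simp]: "bisubst 1 a b = 1"
  and bisubst_w1 [simp]: "bisubst w1 a b = a"
  and bisubst_w2 [simp]: "bisubst w2 a b = b"
  by (simp_all add: bisubst_def w1_def w2_def map_poly_pCons)

lemma bisubst_unique:
  fixes H :: "S \<Rightarrow> 'r::comm_ring_1"
  assumes add: "\<And>f g. H (f + g) = H f + H g" and mult: "\<And>f g. H (f * g) = H f * H g"
    and one: "H 1 = 1"
  shows "H f = bisubst f (H w1) (H w2)"
proof -
  have H0: "H 0 = 0" using add[of 0 0] by simp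
  have c: "H [:[:c:]:] = of_bit c" for c
    using one H0 by (cases c) (simp_all add: one_pCons)
  have p: "H [:p:] = poly (map_poly of_bit p) (H w1)" for p
  proof (induction p)
    case (pCons c p)
    have "[:pCons c p:] = [:[:c:]:] + w1 * [:p:]" by (simp add: w1_def)
    then have "H [:pCons c p:] = H [:[:c:]:] + H w1 * H [:p:]" by (simp only: add mult)
    then show ?case using pCons by (simp add: c map_poly_pCons)
  qed (simp add: H0)
  show ?thesis
  proof (induction f)
    case (pCons q f)
    have "pCons q f = [:q:] + w2 * f" by (simp add: w2_def)
    then have "H (pCons q f) = H [:q:] + H w2 * H f" by (simp only: add mult)
    then show ?case using pCons by (simp add: p map_poly_pCons bisubst_def)
  qed (simp add: H0)
qed

lemma two_S: "(2::S) = 0" and two_St: "(2::S poly) = 0"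
  by (simp_all add: numeral_poly)

lemma sq_tot_add: "sq_tot (f + g) = sq_tot f + sq_tot g"
  and Cartan: "sq_tot (f * g) = sq_tot f * sq_tot g"
  and sq_tot_0 [simp]: "sq_tot 0 = 0"
  and sq_tot_1 [simp]: "sq_tot 1 = 1"
  and sq_tot_w1: "sq_tot w1 = [:w1, w1 ^ 2:]"
  and sq_tot_w2: "sq_tot w2 = [:w2:] * [:1, w1, w2:]"
  unfolding sq_tot_def
  by (simp_all only: bisubst_add[OF two_St] bisubst_mult[OF two_St] bisubst_0 bisubst_1
      bisubst_w1 bisubst_w2)

lemma Thom_Cartan:
  "Sq_M 0 f = Sq_S 0 f"
  "Sq_M 1 f = Sq_S 1 f + w1 * Sq_S 0 f"
  "Sq_M (k + 2) f = Sq_S (k + 2) f + w1 * Sq_S (k + 1) f + w2 * Sq_S k f"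
  by (simp_all add: Sq_M_def Sq_S_def coeff_pCons algebra_simps split: nat.splits)

text \<open>The splitting principle: \<open>S\<close> embeds in $\mathbb{F}_2[x,y]$.\<close>

definition x_root :: "bit poly poly" where "x_root = [:[:0, 1:]:]"

definition y_root :: "bit poly poly" where "y_root = [:0, 1:]"

definition sq_tot_xy :: "bit poly poly \<Rightarrow> bit poly poly poly" where
  "sq_tot_xy f = bisubst f [:x_root, x_root ^ 2:] [:y_root, y_root ^ 2:]"

definition splitting :: "S \<Rightarrow> bit poly poly" where
  "splitting f = bisubst f (x_root + y_root) (x_root * y_root)"

lemma x_root_w1: "x_root = w1" and y_root_w2: "y_root = w2"
  by (simp_all add: x_root_def y_root_def w1_def w2_def)

lemma sq_tot_xy_add: "sq_tot_xy (f + g) = sq_tot_xy f + sq_tot_xy g"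
  and sq_tot_xy_mult: "sq_tot_xy (f * g) = sq_tot_xy f * sq_tot_xy g"
  and sq_tot_xy_0 [simp]: "sq_tot_xy 0 = 0"
  and sq_tot_xy_1 [simp]: "sq_tot_xy 1 = 1"
  and sq_tot_xy_x: "sq_tot_xy x_root = [:x_root, x_root ^ 2:]"
  and sq_tot_xy_y: "sq_tot_xy y_root = [:y_root, y_root ^ 2:]"
  unfolding sq_tot_xy_def
  by (simp_all add: bisubst_add[OF two_St] bisubst_mult[OF two_St]) (simp_all add: x_root_w1 y_root_w2)

lemma splitting_add: "splitting (f + g) = splitting f + splitting g"
  and splitting_mult: "splitting (f * g) = splitting f * splitting g"
  and splitting_0 [simp]: "splitting 0 = 0"
  and splitting_1 [simp]: "splitting 1 = 1"
  and splitting_w1 [simp]: "splitting w1 = x_root + y_root"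
  and splitting_w2 [simp]: "splitting w2 = x_root * y_root"
  unfolding splitting_def
  by (simp_all add: bisubst_add[OF two_S] bisubst_mult[OF two_S])

lemma splitting_minus: "splitting (f - g) = splitting f - splitting g"
  using splitting_add[of "f - g" g] by simp

lemma inj_splitting: "inj splitting"
proof -
  define \<psi> where "\<psi> g = bisubst g y_root (w1 + y_root)" for g
  have "splitting f = 0 \<Longrightarrow> f = 0" for f
  proof -
    assume f: "splitting f = 0"
    have "\<psi> (splitting f) = bisubst f (\<psi> (splitting w1)) (\<psi> (splitting w2))"
      unfolding \<psi>_def
      by (rule bisubst_unique)
        (simp_all add: splitting_add splitting_mult bisubst_add[OF two_S] bisubst_mult[OF two_S])
    also have "\<psi> (splitting w1) = w1"
    proof -
      have "\<psi> (splitting w1) = w1 + 2 * y_root"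
        unfolding \<psi>_def splitting_w1 bisubst_add[OF two_S]
        by (simp add: x_root_w1) (simp add: y_root_w2)
      then show ?thesis by (simp add: two_S)
    qed
    also have "\<psi> (splitting w2) = [:0, [:0, 1:], 1:]"
      unfolding \<psi>_def splitting_w2 bisubst_mult[OF two_S]
      by (simp add: x_root_w1) (simp add: y_root_w2, simp add: w1_def w2_def)
    also have "bisubst f w1 [:0, [:0, 1:], 1:] = pcompose f [:0, [:0, 1:], 1:]"
    proof -
      have "pcompose f [:0, [:0, 1:], 1:]
          = bisubst f (pcompose w1 [:0, [:0, 1:], 1:]) (pcompose w2 [:0, [:0, 1:], 1:])"
        by (rule bisubst_unique) (simp_all add: pcompose_add pcompose_mult pcompose_1)
      then show ?thesis by (simp add: w1_def w2_def pcompose_pCons)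
    qed
    finally have "pcompose f [:0, [:0, 1:], 1:] = 0"
      using f by (simp add: \<psi>_def)
    then show "f = 0"
      by (rule pcompose_eq_0) simp
  qed
  then show ?thesis
    by (metis (no_types, lifting) injI eq_iff_diff_eq_0 splitting_minus)
qed

lemma map_poly_splitting_mult: "map_poly splitting (f * g) = map_poly splitting f * map_poly splitting g"
proof (induction f)
  case (pCons c f)
  have "map_poly splitting (smult c g) = smult (splitting c) (map_poly splitting g)"
    by (intro poly_eqI) (simp add: coeff_map_poly splitting_mult)
  moreover have "map_poly splitting (p + q) = map_poly splitting p + map_poly splitting q" for p q
    by (intro poly_eqI) (simp add: coeff_map_poly splitting_add)
  ultimately show ?case using pCons by (simp add: map_poly_pCons)
qed simp

theorem splitting_sq_tot: "sq_tot_xy (splitting f) = map_poly splitting (sq_tot f)"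
proof -
  have 1: "map_poly splitting (p + q) = map_poly splitting p + map_poly splitting q" for p q
    by (intro poly_eqI) (simp add: coeff_map_poly splitting_add)
  have "sq_tot_xy (splitting f) = bisubst f (sq_tot_xy (splitting w1)) (sq_tot_xy (splitting w2))"
    by (rule bisubst_unique) (simp_all add: splitting_add splitting_mult sq_tot_xy_add sq_tot_xy_mult)
  moreover have "map_poly splitting (sq_tot f)
      = bisubst f (map_poly splitting (sq_tot w1)) (map_poly splitting (sq_tot w2))"
    by (rule bisubst_unique)
      (simp_all add: splitting_add splitting_mult sq_tot_add Cartan 1 map_poly_splitting_mult)
  moreover have "sq_tot_xy (splitting w1) = map_poly splitting (sq_tot w1)"
  proof -
    have "(x_root + y_root) ^ 2 = x_root ^ 2 + y_root ^ 2 + 2 * x_root * y_root"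
      by (simp add: power2_eq_square algebra_simps)
    then have "(x_root + y_root) ^ 2 = x_root ^ 2 + y_root ^ 2" by (simp add: two_S)
    moreover have "splitting (w1 ^ 2) = (x_root + y_root) ^ 2" by (simp add: power2_eq_square splitting_mult)
    ultimately show ?thesis
      by (simp add: sq_tot_w1 sq_tot_xy_add sq_tot_xy_x sq_tot_xy_y map_poly_pCons)
  qed
  moreover have "sq_tot_xy (splitting w2) = map_poly splitting (sq_tot w2)"
    by (simp add: sq_tot_w2 sq_tot_xy_mult sq_tot_xy_x sq_tot_xy_y map_poly_pCons
        splitting_mult splitting_add power2_eq_square algebra_simps)
  ultimately show ?thesis by simp
qed

section \<open>The Adem relations hold on \<open>M\<close>\<close>

definition adem_coeff :: "nat \<Rightarrow> nat \<Rightarrow> nat \<Rightarrow> nat" where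
  "adem_coeff a b c = (if 2 * c \<le> a then (b - c - 1) choose (a - 2 * c) else 0)"

definition Sq_xy :: "nat \<Rightarrow> bit poly poly \<Rightarrow> bit poly poly" where
  "Sq_xy k f = coeff (sq_tot_xy f) k"

lemma Sq_xy_add: "Sq_xy k (f + g) = Sq_xy k f + Sq_xy k g"
  and Sq_xy_0 [simp]: "Sq_xy k 0 = 0"
  and Sq_xy_1: "Sq_xy k 1 = (if k = 0 then 1 else 0)"
  by (simp_all add: Sq_xy_def sq_tot_xy_add)

definition adem_holds :: "bit poly poly \<Rightarrow> bool" where
  "adem_holds f \<longleftrightarrow> (\<forall>a b. a < 2 * b \<longrightarrow>
     Sq_xy a (Sq_xy b f) = (\<Sum>c<b. of_nat (adem_coeff a b c) * Sq_xy (a + b - c) (Sq_xy c f)))"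

definition sh :: "(nat \<Rightarrow> 'a::zero) \<Rightarrow> nat \<Rightarrow> 'a" where
  "sh F k = (case k of 0 \<Rightarrow> 0 | Suc j \<Rightarrow> F j)"

lemma coeff_linear_factor:
  "coeff ([:z, z ^ 2:] * p) k = z * coeff p k + z ^ 2 * sh (coeff p) k" for z :: "'a::comm_ring_1"
  by (cases k) (simp_all add: sh_def)

lemma adem_holds_1: "adem_holds 1"
  unfolding adem_holds_def
proof (intro allI impI)
  fix a b :: nat assume "a < 2 * b"
  have "Sq_xy (a + b - c) (Sq_xy c 1) = 0" if "c < b" for c
    using that by (auto simp: Sq_xy_1)
  then show "Sq_xy a (Sq_xy b 1)
      = (\<Sum>c<b. of_nat (adem_coeff a b c) * Sq_xy (a + b - c) (Sq_xy c 1))"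
    using \<open>a < 2 * b\<close> by (auto simp: Sq_xy_1)
qed

lemma adem_holds_0: "adem_holds 0"
  by (simp add: adem_holds_def)

lemma adem_holds_add: "adem_holds f \<Longrightarrow> adem_holds g \<Longrightarrow> adem_holds (f + g)"
  by (simp add: adem_holds_def Sq_xy_add sum.distrib ring_distribs)

lemma two_mult_S: "p + p = (0::S)"
  using two_S by (metis mult_2 mult_zero_left)

lemma even_of_nat_S: "even n \<Longrightarrow> of_nat n = (0::S)"
  by (auto elim!: evenE simp: two_S)

lemma adem_coeff_pascal:
  assumes "c + 1 < b" "a \<ge> 1"
  shows "of_nat (adem_coeff a b c + adem_coeff a b (c + 1))
       = (of_nat (adem_coeff (a - 1) b c + adem_coeff a (b - 1) c) :: S)"
proof -
  obtain d where b: "b = c + 2 + d" using assms by (metis add.assoc add.commute add_2_eq_Suc' less_iff_Suc_add Suc_eq_plus1 add_Suc_right add_Suc)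
  consider "a < 2 * c" | "a = 2 * c" | "a = 2 * c + 1" | "a \<ge> 2 * c + 2" by linarith
  then show ?thesis
  proof cases
    case 1
    then show ?thesis by (simp add: adem_coeff_def)
  next
    case 2
    then show ?thesis using assms by (simp add: adem_coeff_def)
  next
    case 3
    have "of_nat (Suc d) = of_nat 1 + (of_nat d :: S)" by simp
    then show ?thesis using 3 by (simp add: adem_coeff_def b)
  next
    case 4
    then obtain e where a: "a = 2 * c + 2 + e" using le_Suc_ex by blast
    have "adem_coeff a b c + adem_coeff a b (c + 1)
        = (Suc d choose (Suc (Suc e))) + (d choose e)"
      by (simp add: adem_coeff_def a b)
    moreover have "adem_coeff (a - 1) b c + adem_coeff a (b - 1) c
        = (Suc d choose (Suc e)) + (d choose (Suc (Suc e)))"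
      by (simp add: adem_coeff_def a b)
    ultimately show ?thesis by simp
  qed
qed

lemma adem_holds_mult:
  assumes z: "sq_tot_xy z = [:z, z ^ 2:]" and f: "adem_holds f"
  shows "adem_holds (z * f)"
  unfolding adem_holds_def
proof (intro allI impI)
  fix a b :: nat assume ab: "a < 2 * b"
  define Q where "Q k g = Sq_xy k g" for k g
  define Qm where "Qm k g = (if k = 0 then 0 else Q (k - 1) g)" for k g
  define Qmm where "Qmm k g = (if k < 2 then 0 else Q (k - 2) g)" for k g
  define K where "K a b c = (of_nat (adem_coeff a b c) :: S)" for a b c
  have IH: "Q a (Q b f) = (\<Sum>c<b. K a b c * Q (a + b - c) (Q c f))" if "a < 2 * b" for a b
    using f that by (simp add: adem_holds_def Q_def K_def)
  have Q0 [simp]: "Q k 0 = 0" and Qm0 [simp]: "Qm k 0 = 0" and Qmm0 [simp]: "Qmm k 0 = 0" for k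
    by (simp_all add: Q_def Qm_def Qmm_def)
  have Qadd: "Q k (g + h) = Q k g + Q k h" for k g h by (simp add: Q_def Sq_xy_add)
  have Qz: "Q k (z * g) = z * Q k g + z ^ 2 * Qm k g" for k g
    by (cases k) (simp_all add: Q_def Qm_def Sq_xy_def sq_tot_xy_mult z)
  have zz: "sq_tot_xy (z ^ 2) = [:z ^ 2, 0, z ^ 4:]"
  proof -
    have "z * z ^ 2 + z ^ 2 * z = 0"
      using two_mult_S[of "z ^ 2 * z"] by (simp add: mult.commute)
    moreover have "z ^ 2 * z ^ 2 = z ^ 4" by (simp flip: power_add)
    moreover have "sq_tot_xy (z ^ 2) = [:z, z ^ 2:] * [:z, z ^ 2:]"
      by (simp only: power2_eq_square sq_tot_xy_mult z)
    ultimately show ?thesis by (simp add: power2_eq_square)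
  qed
  have Qzz: "Q k (z ^ 2 * g) = z ^ 2 * Q k g + z ^ 4 * Qmm k g" for k g
    by (simp add: Q_def Qmm_def Sq_xy_def sq_tot_xy_mult zz coeff_pCons split: nat.splits)
  have QQ: "Q k (Q l (z * f)) = z * Q k (Q l f) + z ^ 2 * (Qm k (Q l f) + Q k (Qm l f))
      + z ^ 4 * Qmm k (Qm l f)" for k l
    by (simp only: Qz Qadd Qzz) (simp add: algebra_simps)
  obtain d where b: "b = Suc d" using ab by (cases b) auto
  have ii: "Qm a (Q b f) + Q a (Qm b f)
      = (\<Sum>c<b. K a b c * (Qm (a + b - c) (Q c f) + Q (a + b - c) (Qm c f)))"
  proof -
    let ?P = "\<lambda>c. Q (a + d - c) (Q c f)"
    have A: "(\<Sum>c<b. K a b c * Qm (a + b - c) (Q c f)) = (\<Sum>c<d. K a b c * ?P c) + K a b d * ?P d"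
      unfolding b by (simp add: Qm_def Suc_diff_le cong: sum.cong_simp)
    have B: "(\<Sum>c<b. K a b c * Q (a + b - c) (Qm c f)) = (\<Sum>c<d. K a b (Suc c) * ?P c)"
      unfolding b by (simp add: sum.lessThan_Suc_shift Qm_def del: sum.lessThan_Suc)
    have S: "(\<Sum>c<b. K a b c * (Qm (a + b - c) (Q c f) + Q (a + b - c) (Qm c f)))
        = (\<Sum>c<d. (K a b c + K a b (Suc c)) * ?P c) + K a b d * ?P d"
      unfolding ring_distribs sum.distrib A B by (simp add: algebra_simps)
    show ?thesis
    proof (cases "a = 0")
      case True
      have "K a b c + K a b (Suc c) = K a d c" if "c < d" for c
        using that True by (simp add: K_def adem_coeff_def)
      then have "(\<Sum>c<b. K a b c * (Qm (a + b - c) (Q c f) + Q (a + b - c) (Qm c f)))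
          = (\<Sum>c<d. K a d c * ?P c) + K a b d * ?P d"
        unfolding S by simp
      also have "\<dots> = Q a (Q d f)"
      proof (cases "d = 0")
        case True
        then show ?thesis using \<open>a = 0\<close> b by (simp add: K_def adem_coeff_def)
      next
        case False
        then show ?thesis using IH[of a d] \<open>a = 0\<close> b by (simp add: K_def adem_coeff_def)
      qed
      finally show ?thesis using True by (simp add: Qm_def b)
    next
      case False
      have "K a b c + K a b (Suc c) = K (a - 1) b c + K a d c" if "c < d" for c
        using adem_coeff_pascal[of c b a] that False by (simp add: K_def b)
      then have "(\<Sum>c<b. K a b c * (Qm (a + b - c) (Q c f) + Q (a + b - c) (Qm c f)))
          = (\<Sum>c<d. K (a - 1) b c * ?P c) + (\<Sum>c<d. K a d c * ?P c) + K a b d * ?P d"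
        unfolding S by (simp add: sum.distrib ring_distribs)
      moreover have "Qm a (Q b f) = (\<Sum>c<d. K (a - 1) b c * ?P c) + K (a - 1) b d * ?P d"
        using IH[of "a - 1" b] ab False by (simp add: Qm_def b)
      moreover have "Q a (Q d f) + K (a - 1) b d * ?P d = (\<Sum>c<d. K a d c * ?P c) + K a b d * ?P d"
      proof -
        have 0: "(\<Sum>c<d. K a d c * ?P c) = 0" if "a \<ge> 2 * d"
          using that by (intro sum.neutral) (auto simp: K_def adem_coeff_def binomial_eq_0)
        consider "a < 2 * d" | "a = 2 * d" | "a = 2 * d + 1" using ab b by linarith
        then show ?thesis
        proof cases
          case 1
          then show ?thesis using IH[of a d] False by (simp add: K_def adem_coeff_def)
        next
          case 2
          then show ?thesis using 0 False by (auto simp: K_def adem_coeff_def b)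
        next
          case 3
          then show ?thesis using 0 by (simp add: K_def adem_coeff_def b two_mult_S)
        qed
      qed
      ultimately show ?thesis by (simp add: Qm_def b algebra_simps)
    qed
  qed
  have iii: "Qmm a (Qm b f) = (\<Sum>c<b. K a b c * Qmm (a + b - c) (Qm c f))"
  proof -
    have "(\<Sum>c<b. K a b c * Qmm (a + b - c) (Qm c f))
        = (\<Sum>c<d. K a b (Suc c) * Qmm (a + d - c) (Q c f))"
      unfolding b by (simp add: sum.lessThan_Suc_shift Qm_def del: sum.lessThan_Suc)
    also have "\<dots> = Qmm a (Q d f)"
    proof (cases "a < 2")
      case True
      then show ?thesis by (simp add: Qmm_def K_def adem_coeff_def)
    next
      case False
      have "K a b (Suc c) * Qmm (a + d - c) (Q c f) = K (a - 2) d c * Q (a - 2 + d - c) (Q c f)"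
        if "c < d" for c
      proof -
        have "a + d - c - 2 = a - 2 + d - c" using False by linarith
        moreover have "(Suc (Suc (2 * c)) \<le> a) = (2 * c \<le> a - 2)" using False by linarith
        ultimately show ?thesis using that False by (simp add: Qmm_def K_def adem_coeff_def b)
      qed
      then show ?thesis using IH[of "a - 2" d] False ab b by (simp add: Qmm_def)
    qed
    finally show ?thesis by (simp add: Qm_def b)
  qed
  have "Q a (Q b (z * f)) = (\<Sum>c<b. K a b c * Q (a + b - c) (Q c (z * f)))"
    unfolding QQ ii iii IH[OF ab]
    by (simp add: ring_distribs sum.distrib sum_distrib_left mult_ac)
  then show "Sq_xy a (Sq_xy b (z * f))
      = (\<Sum>c<b. of_nat (adem_coeff a b c) * Sq_xy (a + b - c) (Sq_xy c (z * f)))"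
    by (simp add: Q_def K_def)
qed

lemma adem_holds_all: "adem_holds f"
proof (induction f)
  case (pCons p f)
  have "adem_holds [:p:]"
  proof (induction p)
    case (pCons c p)
    have "[:pCons c p:] = [:[:c:]:] + x_root * [:p:]" by (simp add: x_root_def)
    moreover have "adem_holds [:[:c:]:]"
      by (cases c) (simp_all add: adem_holds_0 adem_holds_1 flip: one_pCons)
    ultimately show ?case
      using pCons by (simp only: adem_holds_add adem_holds_mult sq_tot_xy_x)
  qed (simp add: adem_holds_0)
  moreover have "pCons p f = [:p:] + y_root * f" by (simp add: y_root_def)
  ultimately show ?case
    using pCons by (simp only: adem_holds_add adem_holds_mult sq_tot_xy_y)
qed (simp add: adem_holds_0)

lemma Sq_M_splitting: "splitting (w2 * Sq_M k f) = Sq_xy k (splitting (w2 * f))"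
proof -
  have "sq_tot (w2 * f) = smult w2 ([:1, w1, w2:] * sq_tot f)"
    by (simp add: Cartan sq_tot_w2 smult_add_right mult.commute)
  then have "w2 * Sq_M k f = coeff (sq_tot (w2 * f)) k"
    by (simp add: Sq_M_def)
  then show ?thesis
    by (simp add: Sq_xy_def splitting_sq_tot coeff_map_poly)
qed

theorem adem_M:
  assumes "a < 2 * b"
  shows "Sq_M a (Sq_M b f)
    = (\<Sum>c\<le>a div 2. of_nat ((b - c - 1) choose (a - 2 * c)) * Sq_M (a + b - c) (Sq_M c f))"
proof -
  define J where "J f = splitting (w2 * f)" for f
  have inj: "f = g" if "J f = J g" for f g
  proof -
    have "w2 * f = w2 * g" using that injD[OF inj_splitting] by (simp only: J_def)
    moreover have "w2 \<noteq> 0" by (simp add: w2_def)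
    ultimately show ?thesis using mult_left_cancel by blast
  qed
  have Jadd: "J (f + g) = J f + J g" for f g by (simp add: J_def ring_distribs splitting_add)
  have J0: "J 0 = 0" by (simp add: J_def)
  have Jsum: "J (sum F A) = (\<Sum>i\<in>A. J (F i))" for A :: "nat set" and F
    by (induction A rule: infinite_finite_induct) (simp_all add: Jadd J0)
  have Jnat: "J (of_nat n * g) = of_nat n * J g" for n g
    by (induction n) (simp_all add: J0 ring_distribs Jadd)
  have JS: "J (Sq_M k f) = Sq_xy k (J f)" for k f
    by (simp add: J_def Sq_M_splitting)
  have "J (Sq_M a (Sq_M b f)) = (\<Sum>c<b. of_nat (adem_coeff a b c) * Sq_xy (a + b - c) (Sq_xy c (J f)))"
    using adem_holds_all[of "J f"] assms by (simp add: JS adem_holds_def)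
  also have "\<dots> = (\<Sum>c\<le>a div 2. of_nat ((b - c - 1) choose (a - 2 * c)) * Sq_xy (a + b - c) (Sq_xy c (J f)))"
    using assms by (intro sum.mono_neutral_cong_right) (auto simp: adem_coeff_def)
  also have "\<dots> = J (\<Sum>c\<le>a div 2. of_nat ((b - c - 1) choose (a - 2 * c)) * Sq_M (a + b - c) (Sq_M c f))"
    by (simp add: Jsum Jnat JS)
  finally show ?thesis by (rule inj)
qed

section \<open>The mod 2 Steenrod algebra\<close>

text \<open>
  The free associative $\mathbb{F}_2$-algebra on symbols \<open>Sq\<^sup>k\<close>, \<open>k \<ge> 0\<close>, is the monoid
  algebra of the free monoid of words; a monoid algebra multiplies basis elements by
  adding exponents, so concatenation of words is written additively.
\<close>

datatype sq_word = Word (letters: "nat list")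

instantiation sq_word :: monoid_add
begin

definition zero_sq_word :: sq_word where "0 = Word []"

definition plus_sq_word :: "sq_word \<Rightarrow> sq_word \<Rightarrow> sq_word" where
  "p + q = Word (letters p @ letters q)"

instance by standard (simp_all add: zero_sq_word_def plus_sq_word_def)

end

type_synonym free_sq = "sq_word \<Rightarrow>\<^sub>0 bit"

definition free_Sq :: "nat \<Rightarrow> free_sq" where
  "free_Sq k = Poly_Mapping.single (Word [k]) 1"

text \<open>In the sum \<open>c \<le> a div 2 < b\<close>, so the natural number subtractions are not truncated.\<close>

definition adem_relations :: "free_sq set" where
  "adem_relations = {free_Sq 0 - 1} \<union>
     {free_Sq a * free_Sq b
        - (\<Sum>c\<le>a div 2. of_nat ((b - c - 1) choose (a - 2 * c)) * (free_Sq (a + b - c) * free_Sq c))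
      | a b. 0 < a \<and> a < 2 * b}"

inductive_set adem_ideal :: "free_sq set" where
  zero: "0 \<in> adem_ideal"
| gen: "r \<in> adem_relations \<Longrightarrow> p * r * q \<in> adem_ideal"
| add: "p \<in> adem_ideal \<Longrightarrow> q \<in> adem_ideal \<Longrightarrow> p + q \<in> adem_ideal"

lemma adem_ideal_mult_left: "p \<in> adem_ideal \<Longrightarrow> q * p \<in> adem_ideal"
proof (induction rule: adem_ideal.induct)
  case (gen r p p')
  then show ?case using adem_ideal.gen[of r "q * p" p'] by (simp add: mult.assoc)
qed (simp_all add: ring_distribs adem_ideal.zero adem_ideal.add)

lemma adem_ideal_mult_right: "p \<in> adem_ideal \<Longrightarrow> p * q \<in> adem_ideal"
proof (induction rule: adem_ideal.induct)
  case (gen r p p')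
  then show ?case using adem_ideal.gen[of r p "p' * q"] by (simp add: mult.assoc)
qed (simp_all add: ring_distribs adem_ideal.zero adem_ideal.add)

lemma adem_ideal_minus: "p \<in> adem_ideal \<Longrightarrow> - p \<in> adem_ideal"
  using adem_ideal_mult_left[of p "- 1"] by simp

lemma adem_ideal_diff: "p \<in> adem_ideal \<Longrightarrow> q \<in> adem_ideal \<Longrightarrow> p - q \<in> adem_ideal"
  using adem_ideal.add[of p "- q"] adem_ideal_minus[of q] by simp

subsection \<open>The action of the free algebra on \<open>M\<close>\<close>

definition word_act :: "sq_word \<Rightarrow> M \<Rightarrow> M" where
  "word_act w = foldr Sq_M (letters w)"

definition free_act :: "free_sq \<Rightarrow> M \<Rightarrow> M" where
  "free_act p f = (\<Sum>w\<in>Poly_Mapping.keys p. scaleM (Poly_Mapping.lookup p w) (word_act w f))"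

lemma free_act_superset:
  assumes "finite W" "Poly_Mapping.keys p \<subseteq> W"
  shows "free_act p f = (\<Sum>w\<in>W. scaleM (Poly_Mapping.lookup p w) (word_act w f))"
  unfolding free_act_def using assms
  by (intro sum.mono_neutral_left) (auto simp: in_keys_iff simp del: bit_not_zero_iff)

lemma free_act_add: "free_act (p + q) f = free_act p f + free_act q f"
proof -
  let ?W = "Poly_Mapping.keys p \<union> Poly_Mapping.keys q"
  have "free_act r f = (\<Sum>w\<in>?W. scaleM (Poly_Mapping.lookup r w) (word_act w f))"
    if "r \<in> {p, q, p + q}" for r
    using that by (intro free_act_superset) (use keys_add[of p q] in auto)
  then show ?thesis
    by (simp only: insert_iff simp_thms lookup_add M.scale_left_distrib sum.distrib)
qed

lemma free_act_0 [simp]: "free_act 0 f = 0"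
  by (simp add: free_act_def)

lemma free_act_single: "free_act (Poly_Mapping.single w c) f = scaleM c (word_act w f)"
  using free_act_superset[of "{w}" "Poly_Mapping.single w c" f] by simp

lemma free_act_diff: "free_act (p - q) f = free_act p f - free_act q f"
  using free_act_add[of "p - q" q f] by simp

lemma free_act_sum: "free_act (sum F A) f = (\<Sum>i\<in>A. free_act (F i) f)"
  by (induction A rule: infinite_finite_induct) (simp_all add: free_act_add)

lemma Sq_M_add: "Sq_M k (f + g) = Sq_M k f + Sq_M k g"
  by (simp add: Sq_M_def sq_tot_add ring_distribs)

lemma Sq_M_zero: "Sq_M 0 f = f"
proof -
  have "coeff (sq_tot f) 0 = bisubst f (coeff (sq_tot w1) 0) (coeff (sq_tot w2) 0)"
    by (rule bisubst_unique) (simp_all add: sq_tot_add Cartan coeff_mult)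
  also have "\<dots> = bisubst f w1 w2" by (simp add: sq_tot_w1 sq_tot_w2)
  also have "\<dots> = f" by (rule bisubst_unique[of "\<lambda>f. f", symmetric]) simp_all
  finally show ?thesis by (simp add: Sq_M_def coeff_mult)
qed

lemma word_act_add: "word_act w (f + g) = word_act w f + word_act w g"
proof -
  have "foldr Sq_M ks (f + g) = foldr Sq_M ks f + foldr Sq_M ks g" for ks
    by (induction ks) (simp_all add: Sq_M_add)
  then show ?thesis by (simp add: word_act_def)
qed

lemma word_act_0 [simp]: "word_act w 0 = 0"
  by (metis add_cancel_left_left word_act_add)

lemma word_act_scale: "word_act w (scaleM c f) = scaleM c (word_act w f)"
  by (cases c) (simp_all flip: one_pCons)

lemma free_act_add_right: "free_act p (f + g) = free_act p f + free_act p g"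
  by (simp add: free_act_def word_act_add smult_add_right sum.distrib)

lemma free_act_0_right [simp]: "free_act p 0 = 0"
  by (simp add: free_act_def)

lemma free_induct [case_names zero single add]:
  fixes p :: free_sq
  assumes "P 0" "\<And>w c. P (Poly_Mapping.single w c)" "\<And>p q. P p \<Longrightarrow> P q \<Longrightarrow> P (p + q)"
  shows "P p"
proof -
  have "P (\<Sum>w\<in>W. Poly_Mapping.single w (Poly_Mapping.lookup p w))" for W
    using assms by (induction W rule: infinite_finite_induct) auto
  moreover have "(\<Sum>w\<in>Poly_Mapping.keys p. Poly_Mapping.single w (Poly_Mapping.lookup p w)) = p"
    by (rule poly_mapping_eqI)
      (simp add: lookup_sum lookup_single when_def in_keys_iff del: bit_not_zero_iff)
  ultimately show ?thesis by metis
qed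

lemma free_act_mult: "free_act (p * q) f = free_act p (free_act q f)"
proof (induction p rule: free_induct)
  case (single w c)
  show ?case
  proof (induction q rule: free_induct)
    case (single w' c')
    have "word_act (w + w') f = word_act w (word_act w' f)"
      by (simp add: word_act_def plus_sq_word_def)
    then show ?case by (simp add: mult_single free_act_single word_act_scale)
  qed (simp_all add: ring_distribs free_act_add free_act_add_right)
qed (simp_all add: ring_distribs free_act_add)

lemma free_act_1 [simp]: "free_act 1 f = f"
  by (simp add: free_act_single word_act_def zero_sq_word_def flip: single_one one_pCons)

lemma free_act_of_nat: "free_act (of_nat n) f = of_nat n * f"
  by (induction n) (simp_all add: free_act_add ring_distribs)

lemma free_act_Sq [simp]: "free_act (free_Sq k) f = Sq_M k f"
  by (simp add: free_Sq_def free_act_single word_act_def flip: one_pCons)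

lemma free_act_adem_ideal: "p \<in> adem_ideal \<Longrightarrow> free_act p f = 0"
proof (induction arbitrary: f rule: adem_ideal.induct)
  case (gen r p q)
  have "free_act r g = 0" for g
    using gen adem_M[of _ _ g]
    by (auto simp: adem_relations_def free_act_diff free_act_mult free_act_sum free_act_of_nat
        Sq_M_zero)
  then show ?case by (simp add: free_act_mult)
qed (simp_all add: free_act_add)

subsection \<open>The quotient by the Adem relations\<close>

definition adem_equiv :: "free_sq \<Rightarrow> free_sq \<Rightarrow> bool" where
  "adem_equiv p q \<longleftrightarrow> p - q \<in> adem_ideal"

quotient_type steenrod = free_sq / adem_equiv
proof (rule equivpI)
  show "reflp adem_equiv"
    by (simp add: reflp_def adem_equiv_def adem_ideal.zero)
  show "symp adem_equiv"
    using adem_ideal_minus by (force simp: symp_def adem_equiv_def)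
  show "transp adem_equiv"
  proof (rule transpI)
    fix p q r assume "adem_equiv p q" "adem_equiv q r"
    then show "adem_equiv p r"
      using adem_ideal.add[of "p - q" "q - r"] by (simp add: adem_equiv_def)
  qed
qed

instantiation steenrod :: ring_1
begin

lift_definition zero_steenrod :: steenrod is 0 .

lift_definition one_steenrod :: steenrod is 1 .

lift_definition plus_steenrod :: "steenrod \<Rightarrow> steenrod \<Rightarrow> steenrod" is "(+)"
  unfolding adem_equiv_def by (simp only: add_diff_add adem_ideal.add)

lift_definition uminus_steenrod :: "steenrod \<Rightarrow> steenrod" is uminus
  unfolding adem_equiv_def by (simp only: minus_diff_minus adem_ideal_minus)

lift_definition minus_steenrod :: "steenrod \<Rightarrow> steenrod \<Rightarrow> steenrod" is "(-)"
proof -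
  fix p p' q q' assume "adem_equiv p p'" "adem_equiv q q'"
  moreover have "(p - q) - (p' - q') = (p - p') - (q - q')"
    by (simp add: algebra_simps)
  ultimately show "adem_equiv (p - q) (p' - q')"
    unfolding adem_equiv_def by (simp only: adem_ideal_diff)
qed

lift_definition times_steenrod :: "steenrod \<Rightarrow> steenrod \<Rightarrow> steenrod" is "(*)"
proof -
  fix p p' q q' assume "adem_equiv p p'" "adem_equiv q q'"
  moreover have "p * q - p' * q' = (p - p') * q + p' * (q - q')"
    by (simp add: algebra_simps)
  ultimately show "adem_equiv (p * q) (p' * q')"
    unfolding adem_equiv_def
    by (simp add: adem_ideal.add adem_ideal_mult_left adem_ideal_mult_right)
qed

instance
proof
  show "(0::steenrod) \<noteq> 1"
  proof (transfer, rule notI)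
    assume "adem_equiv 0 1"
    then have "free_act (0 - 1) 1 = 0"
      unfolding adem_equiv_def by (rule free_act_adem_ideal)
    then show False by (simp only: free_act_diff) simp
  qed
qed (transfer, simp add: algebra_simps adem_equiv_def adem_ideal.zero)+

end

definition Sq :: "nat \<Rightarrow> steenrod" where
  "Sq k = abs_steenrod (free_Sq k)"

text \<open>The span of the classes of the words of positive degree.\<close>

definition steenrod_pos :: "steenrod set" where
  "steenrod_pos = {abs_steenrod p | p. \<forall>w \<in> Poly_Mapping.keys p. sum_list (letters w) > 0}"

lift_definition act :: "steenrod \<Rightarrow> M \<Rightarrow> M" is free_act
  using free_act_adem_ideal by (fastforce simp: adem_equiv_def free_act_diff)

lemma act_Sq: "act (Sq k) f = Sq_M k f"
  by (simp add: Sq_def act.abs_eq)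

lemma act_1: "act 1 f = f"
  by transfer simp

lemma act_mult: "act (p * q) f = act p (act q f)"
  by transfer (simp add: free_act_mult)

lemma act_add_left: "act (p + q) f = act p f + act q f"
  by transfer (simp add: free_act_add)

lemma act_add_right: "act p (f + g) = act p f + act p g"
  by transfer (simp add: free_act_add_right)

section \<open>The subalgebra $\mathcal{A}(1)$ and its indecomposables\<close>

text \<open>Over $\mathbb{F}_2$ a subring with unit is a subalgebra.\<close>

inductive_set A1 :: "steenrod set" where
  zero: "0 \<in> A1"
| one: "1 \<in> A1"
| Sq1: "Sq 1 \<in> A1"
| Sq2: "Sq 2 \<in> A1"
| add: "p \<in> A1 \<Longrightarrow> q \<in> A1 \<Longrightarrow> p + q \<in> A1"
| mult: "p \<in> A1 \<Longrightarrow> q \<in> A1 \<Longrightarrow> p * q \<in> A1"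

definition A1_plus :: "steenrod set" where
  "A1_plus = A1 \<inter> steenrod_pos"

definition A1_plus_M :: "M set" where
  "A1_plus_M = M.span {act \<theta> f | \<theta> f. \<theta> \<in> A1_plus}"

text \<open>
  \<open>B\<close> represents a basis of \<open>V / N\<close>: the classes \<open>b + N\<close> for \<open>b \<in> B\<close> are linearly
  independent (in particular pairwise distinct) and span the quotient. A linear combination
  of classes vanishes in \<open>V / N\<close> iff the same combination of representatives lies in \<open>N\<close>.
\<close>

definition represents_basis :: "M set \<Rightarrow> M set \<Rightarrow> M set \<Rightarrow> bool" where
  "represents_basis B V N \<longleftrightarrow> B \<subseteq> V \<and>
     (\<forall>F c. finite F \<and> F \<subseteq> B \<and> (\<Sum>b\<in>F. scaleM (c b) b) \<in> N \<longrightarrow> (\<forall>b\<in>F. c b = 0)) \<and>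
     (\<forall>f\<in>V. \<exists>F c. finite F \<and> F \<subseteq> B \<and> f - (\<Sum>b\<in>F. scaleM (c b) b) \<in> N)"

text \<open>
  \<open>A1_plus_M\<close> is a graded submodule, so its component of internal degree \<open>h\<close> is its
  intersection with \<open>M_deg h\<close>.
\<close>

definition represents_basis_Q1 :: "nat \<Rightarrow> M set \<Rightarrow> bool" where
  "represents_basis_Q1 h B \<longleftrightarrow> represents_basis B (M_deg h) (A1_plus_M \<inter> M_deg h)"

end

theory Submission
  imports Defs
begin

text \<open>
  Modulo \<open>Sq\<^sup>1\<close> and \<open>Sq\<^sup>2\<close>, which have the same image as \<open>\<A>(1)\<^sup>+\<close>, the monomials of internal
  degree \<open>h\<close> interact at most in neighbouring pairs, because
  \<open>Sq\<^sup>1 v\<^bsub>n,m\<^esub> = (n+m+1) v\<^bsub>n+1,m\<^esub>\<close> and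
  \<open>Sq\<^sup>2 v\<^bsub>n,m\<^esub> = binom(n+m+1, 2) v\<^bsub>n+2,m\<^esub> + (m+1) v\<^bsub>n,m+1\<^esub>\<close>.
  Reading the coefficients modulo 2 shows that every monomial outside the list is either hit or
  congruent to \<open>v\<^bsub>0,h/2\<^esub>\<close>. Independence is witnessed by dual functionals that vanish on both
  images: they are coefficient functionals, except that for \<open>h \<equiv> 6 (mod 8)\<close> the one dual to
  \<open>v\<^bsub>0,h/2\<^esub>\<close> is the sum of the coefficients of \<open>v\<^bsub>0,h/2\<^esub>\<close> and \<open>v\<^bsub>2,h/2-1\<^esub>\<close>.
\<close>

section \<open>Monomials and their squares\<close>

lemma v_eq_monom: "v n m = monom (monom 1 n) m"
proof -
  have "[:0, 1:] ^ k = monom 1 k" for k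
    by (simp add: monom_altdef)
  moreover have "[:p:] ^ n = [:p ^ n:]" for p :: "bit poly"
    by (induction n) (simp_all add: one_pCons)
  ultimately show ?thesis
    by (simp add: v_def w1_def w2_def monom_altdef)
qed

text \<open>The only scalars are 0 and 1, so every polynomial is a finite sum of monomials and
  closure under addition suffices.\<close>

lemma S_induct [case_names zero monomial add]:
  fixes f :: S
  assumes "P 0" "\<And>n m. P (v n m)" "\<And>f g. P f \<Longrightarrow> P g \<Longrightarrow> P (f + g)"
  shows "P f"
proof -
  have sum: "P (sum F I)" if "\<And>i. i \<in> I \<Longrightarrow> P (F i)" for F and I :: "nat set"
    using that assms(1,3) by (induction I rule: infinite_finite_induct) auto
  have single: "P (monom (monom c n) m)" for c n m
    using assms(1,2) by (cases c) (simp_all add: v_eq_monom)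
  have "P (monom p m)" for p m
  proof -
    have "monom p m = monom (\<Sum>n\<le>degree p. monom (coeff p n) n) m"
      by (simp only: poly_as_sum_of_monoms)
    also have "\<dots> = (\<Sum>n\<le>degree p. monom (monom (coeff p n) n) m)"
      by (rule monom_sum)
    finally show ?thesis using single by (simp add: sum)
  qed
  then have "P (\<Sum>m\<le>degree f. monom (coeff f m) m)" by (simp add: sum)
  then show ?thesis by (simp add: poly_as_sum_of_monoms)
qed

text \<open>The outer variable is \<open>w2\<close>, so its exponent \<open>m\<close> is read off
  first.\<close>

definition mcoeff :: "nat \<Rightarrow> nat \<Rightarrow> S \<Rightarrow> bit" where
  "mcoeff n m f = coeff (coeff f m) n"

lemma mcoeff_add: "mcoeff n m (f + g) = mcoeff n m f + mcoeff n m g"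
  by (simp add: mcoeff_def)

lemma mcoeff_0 [simp]: "mcoeff n m 0 = 0"
  by (simp add: mcoeff_def)

lemma mcoeff_v: "mcoeff n m (v n' m') = of_bool (n = n' \<and> m = m')"
  by (auto simp: mcoeff_def v_eq_monom)

lemma mcoeff_of_nat_mult: "mcoeff n m (of_nat k * f) = of_nat k * mcoeff n m f"
  by (induction k) (simp_all add: ring_distribs mcoeff_add)

section \<open>The squares of degree 1 and 2 on monomials\<close>

lemma Sq_M_0 [simp]: "Sq_M k 0 = 0"
  by (simp add: Sq_M_def)

text \<open>By the Cartan formula the factor \<open>w1\<close> multiplies the total square on
  \<open>M\<close> by \<open>w1 + w1^2 t\<close>; the coefficients of \<open>t\<close> and
  \<open>t^2\<close> give the recursions in the exponent \<open>n\<close>.\<close>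

lemma Sq_M_w1_mult:
  "Sq_M 1 (w1 * f) = w1 * Sq_M 1 f + w1 ^ 2 * f"
  "Sq_M 2 (w1 * f) = w1 * Sq_M 2 f + w1 ^ 2 * Sq_M 1 f"
proof -
  have "[:1, w1, w2:] * sq_tot (w1 * f) = [:w1, w1 ^ 2:] * ([:1, w1, w2:] * sq_tot f)"
    unfolding Cartan sq_tot_w1 by (simp only: mult.left_commute)
  then have "Sq_M k (w1 * f) = w1 * Sq_M k f + w1 ^ 2 * sh (\<lambda>k. Sq_M k f) k" for k
    unfolding Sq_M_def by (simp only: coeff_linear_factor)
  then show "Sq_M 1 (w1 * f) = w1 * Sq_M 1 f + w1 ^ 2 * f"
    "Sq_M 2 (w1 * f) = w1 * Sq_M 2 f + w1 ^ 2 * Sq_M 1 f"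
    by (simp_all add: sh_def Sq_M_zero numeral_2_eq_2)
qed

text \<open>The total square of \<open>w2\<close> is \<open>w2\<close> times the Thom factor
  \<open>1 + w1 t + w2 t^2\<close>, so this factor is applied a second time and its coefficients are
  compared.\<close>

lemma Sq_M_w2_mult:
  "Sq_M 1 (w2 * f) = w2 * Sq_M 1 f + w1 * w2 * f"
  "Sq_M 2 (w2 * f) = w2 * Sq_M 2 f + w1 * w2 * Sq_M 1 f + w2 ^ 2 * f"
proof -
  define p where "p = [:1, w1, w2:] * sq_tot f"
  have "[:1, w1, w2:] * sq_tot (w2 * f) = [:w2:] * ([:1, w1, w2:] * p)"
    unfolding Cartan sq_tot_w2 p_def by (simp only: ac_simps)
  then have "Sq_M k (w2 * f) = w2 * coeff ([:1, w1, w2:] * p) k" for k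
    by (simp add: Sq_M_def)
  moreover have "coeff p k = Sq_M k f" for k
    by (simp add: p_def Sq_M_def)
  ultimately show "Sq_M 1 (w2 * f) = w2 * Sq_M 1 f + w1 * w2 * f"
    "Sq_M 2 (w2 * f) = w2 * Sq_M 2 f + w1 * w2 * Sq_M 1 f + w2 ^ 2 * f"
    by (simp_all add: Sq_M_zero coeff_pCons numeral_2_eq_2 algebra_simps)
qed

text \<open>Each factor \<open>w1\<close> or \<open>w2\<close> adds one to the coefficient; the
  summand 1 comes from the Thom class.\<close>

lemma Sq_M_1_v: "Sq_M 1 (v n m) = of_nat (n + m + 1) * v (n + 1) m"
proof (induction n)
  case 0
  show ?case
  proof (induction m)
    case (Suc m)
    have "v 0 (Suc m) = w2 * v 0 m" by (simp add: v_def)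
    then show ?case by (simp only: Sq_M_w2_mult Suc) (simp add: v_def algebra_simps)
  qed (simp add: v_def Sq_M_def)
next
  case (Suc n)
  have "v (Suc n) m = w1 * v n m" by (simp add: v_def)
  then show ?case
    by (simp only: Sq_M_w1_mult Suc) (simp add: v_def algebra_simps power2_eq_square)
qed

text \<open>A new factor adds the \<open>Sq^1\<close> coefficient \<open>n + m + 1\<close> to the
  binomial coefficient, which is Pascal's rule. A factor \<open>w2\<close> also adds one to the
  second coefficient.\<close>

lemma Sq_M_2_v:
  "Sq_M 2 (v n m) = of_nat ((n + m + 1) choose 2) * v (n + 2) m + of_nat (m + 1) * v n (m + 1)"
proof (induction n)
  case 0
  show ?case
  proof (induction m)
    case (Suc m)
    have "v 0 (Suc m) = w2 * v 0 m" by (simp add: v_def)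
    then show ?case
      by (simp only: Sq_M_w2_mult Suc Sq_M_1_v)
        (simp add: v_def algebra_simps power2_eq_square numeral_2_eq_2)
  qed (simp add: v_def Sq_M_def numeral_2_eq_2)
next
  case (Suc n)
  have "v (Suc n) m = w1 * v n m" by (simp add: v_def)
  then show ?case
    by (simp only: Sq_M_w1_mult Suc Sq_M_1_v)
      (simp add: v_def algebra_simps power2_eq_square numeral_2_eq_2)
qed

text \<open>Since \<open>k choose 2\<close> is \<open>k (k - 1) / 2\<close>, it is even exactly when
  4 divides one of the two factors; \<open>k + 3\<close> stands for \<open>k - 1\<close> modulo 4.
  The induction goes down in steps of 4, which preserve the parity.\<close>

lemma even_choose_2_iff: "even (k choose 2) \<longleftrightarrow> 4 dvd k \<or> 4 dvd k + 3" for k :: nat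
proof (induction k rule: nat_less_induct)
  case (1 k)
  show ?case
  proof (cases "k < 4")
    case True
    then have "k \<in> {0, 1, 2, 3}" by auto
    then show ?thesis by (auto simp: choose_two)
  next
    case False
    then have "k = Suc (Suc (Suc (Suc (k - 4))))" by presburger
    then obtain j where k: "k = Suc (Suc (Suc (Suc j)))" ..
    have "k choose 2 = 2 * (2 * j + 3) + (j choose 2)"
      unfolding k numeral_2_eq_2 by (simp only: binomial_Suc_Suc choose_one binomial_n_0 One_nat_def) simp
    moreover have "4 dvd k \<longleftrightarrow> 4 dvd j" "4 dvd k + 3 \<longleftrightarrow> 4 dvd j + 3" unfolding k by presburger+
    moreover have "even (j choose 2) \<longleftrightarrow> 4 dvd j \<or> 4 dvd j + 3"
      using 1[rule_format, of j] unfolding k by linarith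
    ultimately show ?thesis by simp
  qed
qed

lemma of_nat_bit: "(of_nat k :: bit) = of_bool (odd k)"
  by (induction k) auto

lemma of_nat_mult_S: "of_nat k * f = (if odd k then f else 0)" for f :: S
  using two_S by (induction k) (auto simp: ring_distribs two_mult_S)

section \<open>The image of the augmentation ideal\<close>

text \<open>This reflects that an element of the algebra is a scalar plus a left combination of the
  two generators. In a product the outermost squares of the left factor stay outermost, and its
  scalar \<open>c\<close> moves inside the squares of the right factor.\<close>

lemma A1_act_decomposition:
  assumes "\<theta> \<in> A1"
  shows "\<exists>c F G. \<forall>f. act \<theta> f = scaleM c f + Sq_M 1 (F f) + Sq_M 2 (G f)"
  using assms
proof induction
  case zero
  have "act 0 f = 0" for f by transfer simp
  then show ?case by (intro exI[of _ 0] exI[of _ "\<lambda>_. 0"]) simp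
next
  case one
  show ?case
    by (intro exI[of _ 1] exI[of _ "\<lambda>_. 0"]) (simp add: act_1 flip: one_pCons)
next
  case Sq1
  show ?case
    by (intro exI[of _ 0] exI[of _ "\<lambda>f. f"] exI[of _ "\<lambda>_. 0"]) (simp add: act_Sq)
next
  case Sq2
  show ?case
    by (intro exI[of _ 0] exI[of _ "\<lambda>_. 0"] exI[of _ "\<lambda>f. f"]) (simp add: act_Sq)
next
  case (add p q)
  then obtain c F G c' F' G' where
    "\<And>f. act p f = scaleM c f + Sq_M 1 (F f) + Sq_M 2 (G f)"
    "\<And>f. act q f = scaleM c' f + Sq_M 1 (F' f) + Sq_M 2 (G' f)" by metis
  then have "act (p + q) f
      = scaleM (c + c') f + Sq_M 1 (F f + F' f) + Sq_M 2 (G f + G' f)" for f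
    by (simp only: act_add_left Sq_M_add M.scale_left_distrib) (simp only: ac_simps)
  then show ?case
    by (intro exI[of _ "c + c'"] exI[of _ "\<lambda>f. F f + F' f"] exI[of _ "\<lambda>f. G f + G' f"]) blast
next
  case (mult p q)
  then obtain c F G c' F' G' where
    p: "\<And>f. act p f = scaleM c f + Sq_M 1 (F f) + Sq_M 2 (G f)" and
    q: "\<And>f. act q f = scaleM c' f + Sq_M 1 (F' f) + Sq_M 2 (G' f)" by metis
  have "scaleM c (Sq_M k f) = Sq_M k (scaleM c f)" for k f
    by (cases c) (simp_all flip: one_pCons)
  then have "act (p * q) f
      = scaleM (c * c') f + Sq_M 1 (scaleM c (F' f) + F (act q f))
          + Sq_M 2 (scaleM c (G' f) + G (act q f))" for f
    by (simp add: act_mult p[of "act q f"] Sq_M_add)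
      (simp add: q smult_add_right algebra_simps)
  then show ?case
    by (intro exI[of _ "c * c'"] exI[of _ "\<lambda>f. scaleM c (F' f) + F (act q f)"]
        exI[of _ "\<lambda>f. scaleM c (G' f) + G (act q f)"]) blast
qed

text \<open>The constant coefficient is a ring homomorphism \<open>\<epsilon>\<close> that kills
  \<open>w1\<close> and \<open>w2\<close>. Applied to coefficients, it makes the Thom factor and the
  total squares of \<open>w1\<close> and \<open>w2\<close> constant in \<open>t\<close>, and such
  polynomials (\<open>const\<close>) are closed under products.\<close>

lemma mcoeff_0_0_Sq_M:
  assumes "k > 0"
  shows "mcoeff 0 0 (Sq_M k f) = 0"
proof -
  define \<epsilon> where "\<epsilon> f = mcoeff 0 0 f" for f
  have mult: "\<epsilon> (f * g) = \<epsilon> f * \<epsilon> g" for f g by (simp add: \<epsilon>_def mcoeff_def coeff_mult)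
  have add: "\<epsilon> (f + g) = \<epsilon> f + \<epsilon> g" for f g by (simp add: \<epsilon>_def mcoeff_add)
  have [simp]: "\<epsilon> 0 = 0" "\<epsilon> 1 = 1" "\<epsilon> w1 = 0" "\<epsilon> w2 = 0"
    by (simp_all add: \<epsilon>_def mcoeff_def w1_def w2_def)
  define const where "const p \<longleftrightarrow> (\<forall>k>0. \<epsilon> (coeff p k) = 0)" for p
  have sum: "\<epsilon> (sum F I) = (\<Sum>i\<in>I. \<epsilon> (F i))" for F and I :: "nat set"
    by (induction I rule: infinite_finite_induct) (simp_all add: add)
  have const_mult: "const (p * q)" if "const p" "const q" for p q
    unfolding const_def
  proof (intro allI impI)
    fix k :: nat assume "k > 0"
    have zero: "\<epsilon> (coeff p i) * \<epsilon> (coeff q (k - i)) = 0" if "i \<le> k" for i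
      using \<open>const p\<close> \<open>const q\<close> \<open>k > 0\<close> that
      by (cases "i = 0") (simp_all add: const_def)
    show "\<epsilon> (coeff (p * q) k) = 0"
      unfolding coeff_mult sum mult by (intro sum.neutral ballI zero) simp
  qed
  have pow: "const (p ^ n)" if "const p" for p n
    using that by (induction n) (simp_all add: const_mult, simp add: const_def)
  have thom: "const [:1, w1, w2:]" and c1: "const [:w1, w1 ^ 2:]" and c2: "const [:w2:]"
    by (auto simp: const_def coeff_pCons mult power2_eq_square split: nat.splits)
  have "const (sq_tot f)"
  proof (induction f rule: S_induct)
    case (monomial n m)
    have "sq_tot (g ^ k) = sq_tot g ^ k" for g k by (induction k) (simp_all add: Cartan)
    then have "sq_tot (v n m) = [:w1, w1 ^ 2:] ^ n * ([:w2:] * [:1, w1, w2:]) ^ m"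
      by (simp only: v_def Cartan sq_tot_w1 sq_tot_w2)
    then show ?case by (simp only: const_mult pow thom c1 c2)
  qed (simp_all add: const_def sq_tot_add add)
  then have "const ([:1, w1, w2:] * sq_tot f)" by (intro const_mult thom)
  then show ?thesis using assms by (simp only: const_def Sq_M_def \<epsilon>_def)
qed

text \<open>A word of positive degree may begin with letters 0, which act as the identity; its first
  positive letter kills the constant coefficient.\<close>

lemma steenrod_pos_mcoeff_0_0:
  assumes "\<theta> \<in> steenrod_pos"
  shows "mcoeff 0 0 (act \<theta> f) = 0"
proof -
  obtain p where \<theta>: "\<theta> = abs_steenrod p" and
    p: "\<And>w. w \<in> Poly_Mapping.keys p \<Longrightarrow> sum_list (letters w) > 0"
    using assms by (auto simp: steenrod_pos_def)
  have word: "mcoeff 0 0 (foldr Sq_M ks f) = 0" if "sum_list ks > 0" for ks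
    using that
  proof (induction ks)
    case (Cons k ks)
    then show ?case by (cases "k = 0") (simp_all add: Sq_M_zero mcoeff_0_0_Sq_M)
  qed simp
  have "mcoeff 0 0 (scaleM c g) = c * mcoeff 0 0 g" for c g
    by (simp add: mcoeff_def)
  moreover have "mcoeff 0 0 (sum F I) = (\<Sum>i\<in>I. mcoeff 0 0 (F i))" for F and I :: "sq_word set"
    by (induction I rule: infinite_finite_induct) (simp_all add: mcoeff_add)
  ultimately show ?thesis
    using p by (simp add: \<theta> act.abs_eq free_act_def word_act_def word)
qed

text \<open>Positive degree forces the scalar in the decomposition of an element of
  \<open>A1\<close> to vanish, and what remains lies in the two images.\<close>

lemma A1_plus_M_eq: "A1_plus_M = {Sq_M 1 f + Sq_M 2 g | f g. True}" (is "_ = ?N")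
proof (intro equalityI subsetI)
  have Sq_scale: "scaleM c (Sq_M k f) = Sq_M k (scaleM c f)" for c k f
    by (cases c) (simp_all flip: one_pCons)
  have "M.subspace ?N"
  proof (rule M.subspaceI)
    show "0 \<in> ?N" by (intro CollectI exI[of _ 0]) simp
    show "x + y \<in> ?N" if "x \<in> ?N" "y \<in> ?N" for x y
    proof -
      from that obtain f g f' g' where
        "x = Sq_M 1 f + Sq_M 2 g" "y = Sq_M 1 f' + Sq_M 2 g'" by blast
      then have "x + y = Sq_M 1 (f + f') + Sq_M 2 (g + g')" by (simp only: Sq_M_add ac_simps)
      then show ?thesis by blast
    qed
    show "scaleM c x \<in> ?N" if "x \<in> ?N" for c x
    proof -
      from that obtain f g where "x = Sq_M 1 f + Sq_M 2 g" by blast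
      then have "scaleM c x = Sq_M 1 (scaleM c f) + Sq_M 2 (scaleM c g)"
        by (simp only: smult_add_right Sq_scale)
      then show ?thesis by blast
    qed
  qed
  moreover have "act \<theta> f \<in> ?N" if \<theta>: "\<theta> \<in> A1_plus" for \<theta> f
  proof -
    obtain c F G where eq: "\<And>f. act \<theta> f = scaleM c f + Sq_M 1 (F f) + Sq_M 2 (G f)"
      using A1_act_decomposition \<theta> unfolding A1_plus_def by (metis IntE)
    \<comment> \<open>Acting on the Thom class, whose coordinate is 1, isolates \<open>c\<close> as
      the constant coefficient.\<close>
    have "mcoeff 0 0 (act \<theta> 1) = 0"
      using \<theta> by (intro steenrod_pos_mcoeff_0_0) (simp add: A1_plus_def)
    then have "c = 0"
      by (simp only: eq mcoeff_add mcoeff_0_0_Sq_M) (simp add: mcoeff_def)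
    then show ?thesis using eq[of f] by auto
  qed
  ultimately show "x \<in> ?N" if "x \<in> A1_plus_M" for x
    using that M.span_minimal[of "{act \<theta> f | \<theta> f. \<theta> \<in> A1_plus}" ?N]
    unfolding A1_plus_M_def by blast
next
  fix x assume "x \<in> ?N"
  then obtain f g where x: "x = Sq_M 1 f + Sq_M 2 g" by blast
  have pos: "Sq k \<in> steenrod_pos" if "k > 0" for k
    using that by (force simp: steenrod_pos_def Sq_def free_Sq_def)
  have "Sq 1 \<in> A1_plus" "Sq 2 \<in> A1_plus"
    using A1.Sq1 A1.Sq2 pos[of 1] pos[of 2] by (simp_all add: A1_plus_def)
  then have "act (Sq 1) f \<in> A1_plus_M" "act (Sq 2) g \<in> A1_plus_M"
    unfolding A1_plus_M_def by (blast intro: M.span_base)+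
  then show "x \<in> A1_plus_M"
    unfolding x act_Sq A1_plus_M_def by (rule M.span_add)
qed

lemma Sq_M_in_A1_plus_M: "Sq_M 1 f \<in> A1_plus_M" "Sq_M 2 f \<in> A1_plus_M"
  unfolding A1_plus_M_eq by (metis (mono_tags, lifting) add_0 add_0_right mem_Collect_eq Sq_M_0)+

text \<open>Reduces the vanishing of a dual functional to the explicit formulas on
  monomials.\<close>

lemma additive_vanishes_on_A1_plus_M:
  assumes "f \<in> A1_plus_M" and add: "\<And>f g. \<phi> (f + g) = \<phi> f + (\<phi> g :: bit)"
    and "\<And>n m. \<phi> (Sq_M 1 (v n m)) = 0" "\<And>n m. \<phi> (Sq_M 2 (v n m)) = 0"
  shows "\<phi> f = 0"
proof -
  have "\<phi> 0 = 0" using add[of 0 0] by simp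
  then have "\<phi> (Sq_M 1 g) = 0 \<and> \<phi> (Sq_M 2 g) = 0" for g
    by (induction g rule: S_induct) (simp_all add: assms Sq_M_add del: One_nat_def)
  then show ?thesis using assms(1) by (auto simp: A1_plus_M_eq add)
qed

section \<open>The basis\<close>

text \<open>A functional that kills \<open>N\<close> and singles out \<open>b\<close> extracts the
  coefficient of \<open>b\<close> from any relation modulo \<open>N\<close>. Additive maps into
  \<open>bit\<close> are automatically linear.\<close>

lemma represents_basisI:
  assumes N: "M.subspace N" and V: "V = M.span G" and "B \<subseteq> G" and G: "G \<subseteq> M.span (B \<union> N)"
    and dual: "\<And>b. b \<in> B \<Longrightarrow> \<exists>\<phi>. (\<forall>f g. \<phi> (f + g) = \<phi> f + (\<phi> g :: bit)) \<and> \<phi> b = 1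
      \<and> (\<forall>b'\<in>B - {b}. \<phi> b' = 0) \<and> (\<forall>f\<in>N. \<phi> f = 0)"
  shows "represents_basis B V (N \<inter> V)"
  unfolding represents_basis_def
proof (intro conjI allI impI ballI)
  show BV: "B \<subseteq> V" using assms M.span_superset by blast
  show "c b = 0"
    if F: "finite F \<and> F \<subseteq> B \<and> (\<Sum>b\<in>F. scaleM (c b) b) \<in> N \<inter> V" and "b \<in> F" for F c b
  proof -
    obtain \<phi> where add: "\<And>f g. \<phi> (f + g) = \<phi> f + (\<phi> g :: bit)" and b: "\<phi> b = 1"
      and other: "\<And>b'. b' \<in> B - {b} \<Longrightarrow> \<phi> b' = 0" and "\<And>f. f \<in> N \<Longrightarrow> \<phi> f = 0"
      using dual[of b] F \<open>b \<in> F\<close> by blast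
    have \<phi>0: "\<phi> 0 = 0" using add[of 0 0] by simp
    have scale: "\<phi> (scaleM d f) = d * \<phi> f" for d f
      by (cases d) (simp_all add: \<phi>0 flip: one_pCons)
    have "\<phi> (sum g I) = (\<Sum>i\<in>I. \<phi> (g i))" for g and I :: "M set"
      by (induction I rule: infinite_finite_induct) (simp_all add: \<phi>0 add)
    then have "\<phi> (\<Sum>b\<in>F. scaleM (c b) b) = (\<Sum>b\<in>F. c b * \<phi> b)" by (simp only: scale)
    also have "\<dots> = (\<Sum>b'\<in>F. if b' = b then c b' else 0)"
    proof (intro sum.cong refl)
      show "c b' * \<phi> b' = (if b' = b then c b' else 0)" if "b' \<in> F" for b'
        using F b other[of b'] that by auto
    qed
    also have "\<dots> = c b" using F \<open>b \<in> F\<close> by simp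
    finally show ?thesis using F \<open>\<And>f. f \<in> N \<Longrightarrow> \<phi> f = 0\<close> by simp
  qed
  fix f assume "f \<in> V"
  then have "f \<in> M.span (B \<union> N)" using G V M.span_minimal M.subspace_span by blast
  then obtain x y where f: "f = x + y" and "x \<in> M.span B" "y \<in> N"
    using N by (auto simp: M.span_Un M.span_eq_iff[THEN iffD2])
  then obtain F c where F: "finite F" "F \<subseteq> B" and x: "x = (\<Sum>b\<in>F. scaleM (c b) b)"
    unfolding M.span_explicit by blast
  \<comment> \<open>The remainder \<open>y = f - x\<close> must lie in \<open>V\<close> as well as
    in \<open>N\<close>.\<close>
  have "x \<in> V"
    using \<open>x \<in> M.span B\<close> BV V M.span_minimal M.subspace_span by blast
  then have "f - x \<in> V" using \<open>f \<in> V\<close> by (simp only: V M.span_diff)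
  then show "\<exists>F c. finite F \<and> F \<subseteq> B \<and> f - (\<Sum>b\<in>F. scaleM (c b) b) \<in> N \<inter> V"
    using F \<open>y \<in> N\<close> by (intro exI[of _ F] exI[of _ c]) (simp add: f flip: x)
qed

lemma represents_basis_Q1I:
  assumes "B \<subseteq> {v n m | n m. n + 2 * m = h}"
    and "\<And>n m. n + 2 * m = h \<Longrightarrow> v n m \<in> M.span (B \<union> A1_plus_M)"
    and "\<And>b. b \<in> B \<Longrightarrow> \<exists>\<phi>. (\<forall>f g. \<phi> (f + g) = \<phi> f + (\<phi> g :: bit)) \<and> \<phi> b = 1
      \<and> (\<forall>b'\<in>B - {b}. \<phi> b' = 0)
      \<and> (\<forall>n m. \<phi> (Sq_M 1 (v n m)) = 0) \<and> (\<forall>n m. \<phi> (Sq_M 2 (v n m)) = 0)"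
  shows "represents_basis_Q1 h B"
  unfolding represents_basis_Q1_def
proof (rule represents_basisI[OF _ M_deg_def assms(1)])
  show "M.subspace A1_plus_M" by (simp add: A1_plus_M_def M.subspace_span)
  show "{v n m | n m. n + 2 * m = h} \<subseteq> M.span (B \<union> A1_plus_M)" using assms(2) by blast
  show "\<exists>\<phi>. (\<forall>f g. \<phi> (f + g) = \<phi> f + (\<phi> g :: bit)) \<and> \<phi> b = 1
      \<and> (\<forall>b'\<in>B - {b}. \<phi> b' = 0) \<and> (\<forall>f\<in>A1_plus_M. \<phi> f = 0)" if "b \<in> B" for b
    using assms(3)[OF that] additive_vanishes_on_A1_plus_M by metis
qed

section \<open>Monomials hit by the squares, and coefficients of the images\<close>

lemma v_in_A1_plus_M_odd:
  assumes "n > 0" "odd (n + m)"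
  shows "v n m \<in> A1_plus_M"
proof -
  have "Sq_M 1 (v (n - 1) m) = v n m"
    unfolding Sq_M_1_v of_nat_mult_S using assms by simp
  then show ?thesis by (metis Sq_M_in_A1_plus_M(1))
qed

lemma Sq_M_2_v_mod_4:
  "Sq_M 2 (v n m) = (if 4 dvd n + m \<or> 4 dvd n + m + 1 then 0 else v (n + 2) m)
    + (if even m then v n (m + 1) else 0)"
proof -
  have "4 dvd n + m + 1 \<or> 4 dvd n + m + 1 + 3 \<longleftrightarrow> 4 dvd n + m \<or> 4 dvd n + m + 1"
    by presburger
  then show ?thesis unfolding Sq_M_2_v of_nat_mult_S even_choose_2_iff by simp
qed

lemma mcoeff_Sq_M_1: "mcoeff n m (Sq_M 1 (v i j)) = of_bool (odd (n + m) \<and> n = i + 1 \<and> m = j)"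
  unfolding Sq_M_1_v mcoeff_of_nat_mult mcoeff_v of_nat_bit by auto

lemma mcoeff_Sq_M_2:
  "mcoeff n m (Sq_M 2 (v i j))
    = of_bool (\<not> (4 dvd i + j \<or> 4 dvd i + j + 1) \<and> n = i + 2 \<and> m = j)
      + of_bool (odd m \<and> n = i \<and> m = j + 1)"
  unfolding Sq_M_2_v_mod_4 mcoeff_add by (auto simp: mcoeff_v)

text \<open>One description covers all \<open>h\<close>. Monomials with \<open>m\<close> even and
  \<open>n + m\<close> congruent to 2 modulo 4, and \<open>v 0 m\<close> with 4 dividing
  \<open>m\<close>, occur in neither image. For \<open>m\<close> congruent to 3 modulo 4,
  \<open>Sq^2\<close> only identifies \<open>v 0 m\<close> with \<open>v 2 (m - 1)\<close>, and the
  former is chosen as representative.\<close>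

lemma represents_basis_Q1_monomials:
  "represents_basis_Q1 h {v n m | n m. n + 2 * m = h
    \<and> (even m \<and> 4 dvd n + m + 2 \<or> n = 0 \<and> (4 dvd m \<or> 4 dvd m + 1))}"
  (is "represents_basis_Q1 h ?B")
proof (rule represents_basis_Q1I)
  show "?B \<subseteq> {v n m | n m. n + 2 * m = h}" by blast
  fix n m assume h: "n + 2 * m = h"
  have in_N: "f \<in> M.span (?B \<union> A1_plus_M)" if "f \<in> A1_plus_M" for f
    using that by (intro M.span_base) simp
  have in_B: "v n m \<in> M.span (?B \<union> A1_plus_M)"
    if "n + 2 * m = h" "even m \<and> 4 dvd n + m + 2 \<or> n = 0 \<and> (4 dvd m \<or> 4 dvd m + 1)" for n m
    using that by (intro M.span_base UnI1 CollectI exI[of _ n] exI[of _ m]) simp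
  have cancel: "f \<in> M.span (?B \<union> A1_plus_M)"
    if "f + g \<in> A1_plus_M" "g \<in> M.span (?B \<union> A1_plus_M)" for f g
    using M.span_diff[OF in_N[OF that(1)] that(2)] by simp
  \<comment> \<open>The cases are: hit by \<open>Sq^1\<close>; \<open>m\<close> odd, treated by
    \<open>Sq^2\<close> of \<open>v n (m - 1)\<close> unless listed; listed with \<open>m\<close>
    even; and \<open>m\<close> even, treated by \<open>Sq^2\<close> of
    \<open>v (n - 2) m\<close>.\<close>
  have "n > 0 \<and> odd (n + m) \<or> odd m \<and> (n = 0 \<or> even (n + m))
    \<or> even m \<and> (4 dvd n + m + 2 \<or> n = 0 \<and> 4 dvd m) \<or> even m \<and> 4 dvd n + m \<and> n > 0"
    by presburger
  then consider "n > 0" "odd (n + m)" | "odd m" "n = 0 \<or> even (n + m)"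
    | "even m" "4 dvd n + m + 2 \<or> n = 0 \<and> 4 dvd m" | "even m" "4 dvd n + m" "n > 0" by metis
  then show "v n m \<in> M.span (?B \<union> A1_plus_M)"
  proof cases
    case 1
    then show ?thesis by (intro in_N v_in_A1_plus_M_odd)
  next
    case 2
    then obtain k where k: "m = k + 1" "even k" by (elim oddE) auto
    show ?thesis
    proof (cases "n = 0 \<and> 4 dvd m + 1")
      case True
      then show ?thesis using h by (intro in_B) auto
    next
      case False
      \<comment> \<open>\<open>?g\<close> is the other term of \<open>Sq_M 2 (v n k)\<close>. If it
        is nonzero, then \<open>n + 2 + k\<close> is odd here and \<open>Sq^1\<close> hits
        it.\<close>
      let ?g = "if 4 dvd n + k \<or> 4 dvd n + k + 1 then 0 else v (n + 2) k"
      have "v n m + ?g = Sq_M 2 (v n k)"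
        unfolding Sq_M_2_v_mod_4 k(1) using k(2) by (simp only: if_True add.commute)
      then have "v n m + ?g \<in> A1_plus_M" using Sq_M_in_A1_plus_M(2)[of "v n k"] by (simp only:)
      moreover have "v (n + 2) k \<in> A1_plus_M" if "\<not> (4 dvd n + k \<or> 4 dvd n + k + 1)"
      proof (rule v_in_A1_plus_M_odd)
        show "odd (n + 2 + k)" using 2 k False that by presburger
      qed simp
      then have "?g \<in> M.span (?B \<union> A1_plus_M)"
        using in_N M.span_zero by (simp only: split: if_split) blast
      ultimately show ?thesis by (rule cancel)
    qed
  next
    case 3
    then show ?thesis using h by (intro in_B) auto
  next
    case 4
    then have "even n" by presburger
    with \<open>n > 0\<close> have "n = n - 2 + 2" by presburger
    then obtain i where i: "n = i + 2" ..
    \<comment> \<open>Here \<open>i + m\<close> is 2 modulo 4, so \<open>Sq_M 2 (v i m)\<close> has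
      both terms and \<open>v n m\<close> is congruent to \<open>v i (m + 1)\<close>. The latter is
      listed for \<open>i = 0\<close> and hit by \<open>Sq^1\<close> otherwise.\<close>
    have "\<not> (4 dvd i + m \<or> 4 dvd i + m + 1)" using 4 unfolding i by presburger
    then have "v n m + v i (m + 1) = Sq_M 2 (v i m)"
      unfolding Sq_M_2_v_mod_4 i using \<open>even m\<close> by (simp only: if_True if_False)
    then have "v n m + v i (m + 1) \<in> A1_plus_M"
      using Sq_M_in_A1_plus_M(2)[of "v i m"] by (simp only:)
    moreover have "v i (m + 1) \<in> M.span (?B \<union> A1_plus_M)"
    proof (cases "i = 0")
      case True
      have "4 dvd m + 1 + 1" using 4(2) unfolding i True by (simp add: add.commute)
      then show ?thesis using h unfolding i True by (intro in_B) simp_all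
    next
      case False
      have "odd (i + (m + 1))" using 4 \<open>even n\<close> unfolding i by simp
      then show ?thesis using False by (intro in_N v_in_A1_plus_M_odd) auto
    qed
    ultimately show ?thesis by (rule cancel)
  qed
next
  fix b assume "b \<in> ?B"
  then obtain n m where b: "b = v n m"
    and nm: "even m \<and> 4 dvd n + m + 2 \<or> n = 0 \<and> (4 dvd m \<or> 4 dvd m + 1)" by auto
  show "\<exists>\<phi>. (\<forall>f g. \<phi> (f + g) = \<phi> f + (\<phi> g :: bit)) \<and> \<phi> b = 1 \<and> (\<forall>b'\<in>?B - {b}. \<phi> b' = 0)
      \<and> (\<forall>n m. \<phi> (Sq_M 1 (v n m)) = 0) \<and> (\<forall>n m. \<phi> (Sq_M 2 (v n m)) = 0)"
  proof (cases "even m")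
    case True
    with nm have m: "4 dvd n + m + 2 \<or> n = 0" by auto
    have "mcoeff n m (Sq_M 1 (v i j)) = 0" for i j
    proof -
      have "\<not> (odd (n + m) \<and> n = i + 1 \<and> m = j)" using m True by presburger
      then show ?thesis unfolding mcoeff_Sq_M_1 by simp
    qed
    moreover have "mcoeff n m (Sq_M 2 (v i j)) = 0" for i j
    proof -
      \<comment> \<open>Either \<open>n = 0\<close>, which excludes \<open>n = i + 2\<close>, or
        \<open>i + j = n + m - 2\<close> is divisible by 4. The other term of \<open>Sq^2\<close>
        only reaches odd \<open>m\<close>.\<close>
      have "\<not> (\<not> (4 dvd i + j \<or> 4 dvd i + j + 1) \<and> n = i + 2 \<and> m = j)"
        using m by presburger
      then show ?thesis using True unfolding mcoeff_Sq_M_2 by simp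
    qed
    ultimately show ?thesis
      by (intro exI[of _ "mcoeff n m"]) (auto simp: b mcoeff_add mcoeff_v)
  next
    case False
    with nm have m: "n = 0" "4 dvd m + 1" by presburger+
    from False obtain k where k: "m = k + 1" "even k" by (elim oddE) auto
    have k4: "\<not> (4 dvd k \<or> 4 dvd k + 1)" "\<not> 4 dvd 2 + k + 2" using m(2) unfolding k(1) by presburger+
    \<comment> \<open>Since \<open>Sq_M 2 (v 0 k) = v 2 k + v 0 m\<close>, the coefficient at
      \<open>v 0 m\<close> alone does not vanish on the image; the second coefficient cancels it. As
      \<open>2 + k\<close> is divisible by 4, \<open>v 2 k\<close> is not listed, so the extra
      summand vanishes on the list.\<close>
    define \<phi> where "\<phi> f = mcoeff 0 m f + mcoeff 2 k f" for f
    have "\<phi> (Sq_M 1 (v i j)) = 0" for i j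
      using k unfolding \<phi>_def mcoeff_Sq_M_1 by auto
    moreover have "\<phi> (Sq_M 2 (v i j)) = 0" for i j
      using k k4 unfolding \<phi>_def mcoeff_Sq_M_2 by auto
    moreover have "\<phi> b' = 0" if b': "b' \<in> ?B - {b}" for b'
    proof -
      obtain i j where "b' = v i j" "v i j \<noteq> b"
        and ij: "even j \<and> 4 dvd i + j + 2 \<or> i = 0 \<and> (4 dvd j \<or> 4 dvd j + 1)"
        using b' by auto
      moreover from this have "\<not> (2 = i \<and> k = j)" using k4(2) by auto
      ultimately show ?thesis using m(1) by (auto simp: \<phi>_def b mcoeff_v)
    qed
    moreover have "\<phi> b = 1"
      using m k by (simp add: \<phi>_def b mcoeff_v)
    moreover have "\<phi> (f + g) = \<phi> f + \<phi> g" for f g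
      by (simp only: \<phi>_def mcoeff_add ac_simps)
    ultimately show ?thesis by (intro exI[of _ \<phi>]) blast
  qed
qed

text \<open>With \<open>n + 2 * m = h\<close>, the condition that 4 divides \<open>n + m + 2\<close>
  says that \<open>m\<close> is congruent to \<open>h + 2\<close> modulo 4. For even
  \<open>m\<close> this gives \<open>m = 2 + 4 * a\<close>, \<open>m = 4 * a\<close> or no solution,
  according to the residue of \<open>h\<close>. For \<open>n = 0\<close> the degree is
  \<open>2 * m\<close>, so \<open>m\<close> congruent to 0 or 3 modulo 4 means \<open>h\<close>
  congruent to 0 or 6 modulo 8.\<close>

theorem corollary6p2:
  fixes h :: nat
  shows "(h mod 4 = 0 \<longrightarrow>
            represents_basis_Q1 h
              ({v (h - 4 - 8 * a) (2 + 4 * a) | a. 4 + 8 * a \<le> h}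
                \<union> (if h mod 8 = 0 then {v 0 (h div 2)} else {})))
       \<and> (h mod 4 = 2 \<longrightarrow>
            represents_basis_Q1 h
              ({v (h - 8 * a) (4 * a) | a. 8 * a \<le> h}
                \<union> (if h mod 8 = 6 then {v 0 (h div 2)} else {})))
       \<and> (odd h \<longrightarrow> represents_basis_Q1 h {})"
proof -
  let ?P = "\<lambda>n m. n + 2 * m = h \<and> (even m \<and> 4 dvd n + m + 2 \<or> n = 0 \<and> (4 dvd m \<or> 4 dvd m + 1))"
  have collect: "{v n m | n m. P n m} = B"
    if "\<And>n m. P n m \<Longrightarrow> v n m \<in> B" "\<And>b. b \<in> B \<Longrightarrow> \<exists>n m. b = v n m \<and> P n m" for P B
    using that by blast
  have basis: "represents_basis_Q1 h B"
    if "\<And>n m. ?P n m \<Longrightarrow> v n m \<in> B" "\<And>b. b \<in> B \<Longrightarrow> \<exists>n m. b = v n m \<and> ?P n m" for B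
  proof -
    have eq: "{v n m | n m. ?P n m} = B" using that by (rule collect)
    show ?thesis unfolding eq[symmetric] by (rule represents_basis_Q1_monomials)
  qed
  have "represents_basis_Q1 h ({v (h - 4 - 8 * a) (2 + 4 * a) | a. 4 + 8 * a \<le> h}
      \<union> (if h mod 8 = 0 then {v 0 (h div 2)} else {}))" (is "represents_basis_Q1 h ?B") if "h mod 4 = 0"
  proof (rule basis)
    have h4: "4 dvd h" using that by presburger
    fix n m assume P: "?P n m"
    show "v n m \<in> ?B"
    proof (cases "4 dvd m + 2")
      case True
      define a where "a = m div 4"
      have m: "m = 2 + 4 * a" using True unfolding a_def by presburger
      with P have n: "n = h - 4 - 8 * a" "4 + 8 * a \<le> h" by linarith+
      show ?thesis unfolding m n(1) using n(2) by blast
    next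
      case False
      with P h4 have m: "n = 0" "4 dvd m" by presburger+
      with P have "h = 2 * m" by simp
      moreover from m(2) have "2 * m mod 8 = 0" by presburger
      ultimately show ?thesis using m(1) by simp
    qed
  next
    have h4: "4 dvd h" using that by presburger
    fix b assume "b \<in> ?B"
    then consider a where "b = v (h - 4 - 8 * a) (2 + 4 * a)" "4 + 8 * a \<le> h"
      | "h mod 8 = 0" "b = v 0 (h div 2)" by (auto split: if_splits)
    then show "\<exists>n m. b = v n m \<and> ?P n m"
    proof cases
      case (1 a)
      \<comment> \<open>Writing \<open>h\<close> as a sum removes the truncated subtractions;
        \<open>d\<close> is the exponent of \<open>w1\<close>.\<close>
      from 1(2) obtain d where d: "h = 4 + 8 * a + d" by (auto simp: le_iff_add)
      have "4 dvd d + (2 + 4 * a) + 2" using h4 unfolding d by presburger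
      then have "?P (h - 4 - 8 * a) (2 + 4 * a)" unfolding d by simp
      with 1 show ?thesis by blast
    next
      case 2
      from 2(1) have "2 * (h div 2) = h" "4 dvd h div 2 \<or> 4 dvd h div 2 + 1" by presburger+
      then have "?P 0 (h div 2)" by simp
      with 2 show ?thesis by blast
    qed
  qed
  moreover have "represents_basis_Q1 h ({v (h - 8 * a) (4 * a) | a. 8 * a \<le> h}
      \<union> (if h mod 8 = 6 then {v 0 (h div 2)} else {}))" (is "represents_basis_Q1 h ?B") if "h mod 4 = 2"
  proof (rule basis)
    have h4: "4 dvd h + 2" using that by presburger
    fix n m assume P: "?P n m"
    show "v n m \<in> ?B"
    proof (cases "4 dvd m")
      case True
      define a where "a = m div 4"
      have m: "m = 4 * a" using True unfolding a_def by presburger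
      with P have n: "n = h - 8 * a" "8 * a \<le> h" by linarith+
      show ?thesis unfolding m n(1) using n(2) by blast
    next
      case False
      with P h4 have m: "n = 0" "4 dvd m + 1" by presburger+
      with P have "h = 2 * m" by simp
      moreover from m(2) have "2 * m mod 8 = 6" by presburger
      ultimately show ?thesis using m(1) by simp
    qed
  next
    have h4: "4 dvd h + 2" using that by presburger
    fix b assume "b \<in> ?B"
    then consider a where "b = v (h - 8 * a) (4 * a)" "8 * a \<le> h"
      | "h mod 8 = 6" "b = v 0 (h div 2)" by (auto split: if_splits)
    then show "\<exists>n m. b = v n m \<and> ?P n m"
    proof cases
      case (1 a)
      from 1(2) obtain d where d: "h = 8 * a + d" by (auto simp: le_iff_add)
      have "4 dvd d + 4 * a + 2" using h4 unfolding d by presburger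
      then have "?P (h - 8 * a) (4 * a)" unfolding d by simp
      with 1 show ?thesis by blast
    next
      case 2
      from 2(1) have "2 * (h div 2) = h" "4 dvd h div 2 \<or> 4 dvd h div 2 + 1" by presburger+
      then have "?P 0 (h div 2)" by simp
      with 2 show ?thesis by blast
    qed
  qed
  moreover have "represents_basis_Q1 h {}" if "odd h"
  proof (rule basis)
    fix n m assume "?P n m"
    with that have False by presburger
    then show "v n m \<in> {}" ..
  qed simp
  ultimately show ?thesis by (intro conjI impI)
qed

end
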